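(* For every real number $p$ with $1 \le p < \infty$, one has $T(L_p[0,1]) = 2^{1/p}$, where $L_p[0,1]$ is the real Lebesgue space over $[0,1]$ with Lebesgue measure and its usual norm, and $T$ is the thickness constant.
   Context: For a real Banach space $X$, let $B_X$ and $S_X$ denote its closed unit ball and its unit sphere, and let $B(x,r)$ denote the closed ball with center $x$ and radius $r$. The (Whitley) thickness constant of $X$ is $$T(X)= \inf\Big\{\varepsilon>0 : \exists\, n\in\mathbb{N},\ \exists\, \{x_1,\dots,x_n\} \subset S_X \text{ such that } B_X\subset\bigcup_{i=1}^{n}B(x_i,\varepsilon) \Big\}.$$ *)

theory Defs
  imports "HOL-Analysis.Analysis"
begin

text \<open>
  The exponent of \<open>L\<^sub>p\<close> is a term-level variable, so the space cannot be an instance of the type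
  class \<^class>\<open>banach\<close>; normed spaces are therefore given by explicit carriers and operations.
\<close>

record 'a real_nspace =
  vcarrier :: "'a set"
  vzero :: 'a
  vadd :: "'a \<Rightarrow> 'a \<Rightarrow> 'a"
  vscale :: "real \<Rightarrow> 'a \<Rightarrow> 'a"
  vnorm :: "'a \<Rightarrow> real"

definition vdiff :: "('a, 'm) real_nspace_scheme \<Rightarrow> 'a \<Rightarrow> 'a \<Rightarrow> 'a" where
  "vdiff X x y = vadd X x (vscale X (- 1) y)"

definition vcball :: "('a, 'm) real_nspace_scheme \<Rightarrow> 'a \<Rightarrow> real \<Rightarrow> 'a set" where
  "vcball X c r = {x \<in> vcarrier X. vnorm X (vdiff X x c) \<le> r}"

definition unit_ball :: "('a, 'm) real_nspace_scheme \<Rightarrow> 'a set" where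
  "unit_ball X = {x \<in> vcarrier X. vnorm X x \<le> 1}"

definition unit_sphere :: "('a, 'm) real_nspace_scheme \<Rightarrow> 'a set" where
  "unit_sphere X = {x \<in> vcarrier X. vnorm X x = 1}"

definition thickness :: "('a, 'm) real_nspace_scheme \<Rightarrow> real" where
  "thickness X = Inf {\<epsilon>. \<epsilon> > 0 \<and>
     (\<exists>C. finite C \<and> C \<subseteq> unit_sphere X \<and> unit_ball X \<subseteq> (\<Union>c\<in>C. vcball X c \<epsilon>))}"


definition Lp_fun :: "'a measure \<Rightarrow> real \<Rightarrow> ('a \<Rightarrow> real) set" where
  "Lp_fun M p = {f \<in> borel_measurable M. integrable M (\<lambda>x. \<bar>f x\<bar> powr p)}"

definition Lp_rel :: "'a measure \<Rightarrow> real \<Rightarrow> (('a \<Rightarrow> real) \<times> ('a \<Rightarrow> real)) set" where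
  "Lp_rel M p = {(f, g). f \<in> Lp_fun M p \<and> g \<in> Lp_fun M p \<and> (AE x in M. f x = g x)}"

definition Lp_fnorm :: "'a measure \<Rightarrow> real \<Rightarrow> ('a \<Rightarrow> real) \<Rightarrow> real" where
  "Lp_fnorm M p f = (\<integral>x. \<bar>f x\<bar> powr p \<partial>M) powr (1 / p)"

text \<open>
  Elements are classes modulo equality almost everywhere. The operations on classes are
  independent of representatives; see \<open>Lp_add_class\<close>, \<open>Lp_scale_class\<close> and \<open>Lp_norm_class\<close>.
\<close>

definition Lp :: "'a measure \<Rightarrow> real \<Rightarrow> ('a \<Rightarrow> real) set real_nspace" where
  "Lp M p = \<lparr>
     vcarrier = Lp_fun M p // Lp_rel M p,
     vzero = Lp_rel M p `` {\<lambda>x. 0},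
     vadd = (\<lambda>F G. \<Union>f\<in>F. \<Union>g\<in>G. Lp_rel M p `` {\<lambda>x. f x + g x}),
     vscale = (\<lambda>a F. \<Union>f\<in>F. Lp_rel M p `` {\<lambda>x. a * f x}),
     vnorm = (\<lambda>F. the_elem (Lp_fnorm M p ` F))\<rparr>"

lemma equiv_Lp_rel: "equiv (Lp_fun M p) (Lp_rel M p)"
proof (rule equivI)
  show "Lp_rel M p \<subseteq> Lp_fun M p \<times> Lp_fun M p" "refl_on (Lp_fun M p) (Lp_rel M p)"
    by (auto simp: Lp_rel_def refl_on_def)
  show "sym (Lp_rel M p)"
    unfolding sym_def Lp_rel_def by (simp add: eq_commute)
  show "trans (Lp_rel M p)"
  proof (rule transI)
    fix f g h assume "(f, g) \<in> Lp_rel M p" "(g, h) \<in> Lp_rel M p"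
    then have "AE x in M. f x = g x" "AE x in M. g x = h x"
      and fh: "f \<in> Lp_fun M p" "h \<in> Lp_fun M p"
      by (auto simp: Lp_rel_def)
    from this(1,2) have "AE x in M. f x = h x"
      by eventually_elim simp
    with fh show "(f, h) \<in> Lp_rel M p"
      by (simp add: Lp_rel_def)
  qed
qed

lemma Lp_fun_scale:
  assumes "f \<in> Lp_fun M p"
  shows "(\<lambda>x. a * f x) \<in> Lp_fun M p"
  using assms unfolding Lp_fun_def by (auto simp: abs_mult powr_mult)

lemma Lp_fun_add:
  assumes p: "0 \<le> p" and f: "f \<in> Lp_fun M p" and g: "g \<in> Lp_fun M p"
  shows "(\<lambda>x. f x + g x) \<in> Lp_fun M p"
proof -
  have [measurable]: "f \<in> borel_measurable M" "g \<in> borel_measurable M"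
    using f g by (auto simp: Lp_fun_def)
  have int: "integrable M (\<lambda>x. 2 powr p * (\<bar>f x\<bar> powr p + \<bar>g x\<bar> powr p))"
    using f g by (auto simp: Lp_fun_def)
  have "\<bar>a + b\<bar> powr p \<le> 2 powr p * (\<bar>a\<bar> powr p + \<bar>b\<bar> powr p)" for a b :: real
  proof -
    have "\<bar>a + b\<bar> powr p \<le> (2 * max \<bar>a\<bar> \<bar>b\<bar>) powr p"
      by (rule powr_mono2[OF p]) auto
    also have "\<dots> = 2 powr p * max \<bar>a\<bar> \<bar>b\<bar> powr p"
      by (simp add: powr_mult)
    also have "\<dots> \<le> 2 powr p * (\<bar>a\<bar> powr p + \<bar>b\<bar> powr p)"
      by (rule mult_left_mono) (auto simp: max_def)
    finally show ?thesis .
  qed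
  then have "integrable M (\<lambda>x. \<bar>f x + g x\<bar> powr p)"
    by (intro Bochner_Integration.integrable_bound[OF int]) auto
  then show ?thesis
    by (simp add: Lp_fun_def)
qed

lemma Lp_add_class:
  assumes "0 \<le> p" "f \<in> Lp_fun M p" "g \<in> Lp_fun M p"
  shows "vadd (Lp M p) (Lp_rel M p `` {f}) (Lp_rel M p `` {g}) = Lp_rel M p `` {\<lambda>x. f x + g x}"
proof -
  have "congruent2 (Lp_rel M p) (Lp_rel M p) (\<lambda>f g. Lp_rel M p `` {\<lambda>x. f x + g x})"
  proof (rule congruent2I')
    fix f f' g g' assume fg: "(f, f') \<in> Lp_rel M p" "(g, g') \<in> Lp_rel M p"
    then have "AE x in M. f x = f' x" "AE x in M. g x = g' x"
      by (auto simp: Lp_rel_def)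
    then have "AE x in M. f x + g x = f' x + g' x"
      by eventually_elim simp
    with fg have "((\<lambda>x. f x + g x), (\<lambda>x. f' x + g' x)) \<in> Lp_rel M p"
      using assms(1) by (simp add: Lp_rel_def Lp_fun_add)
    then show "Lp_rel M p `` {\<lambda>x. f x + g x} = Lp_rel M p `` {\<lambda>x. f' x + g' x}"
      by (rule equiv_class_eq[OF equiv_Lp_rel])
  qed
  from UN_equiv_class2[OF equiv_Lp_rel equiv_Lp_rel this assms(2,3)] show ?thesis
    by (simp add: Lp_def)
qed

lemma Lp_scale_class:
  assumes "f \<in> Lp_fun M p"
  shows "vscale (Lp M p) a (Lp_rel M p `` {f}) = Lp_rel M p `` {\<lambda>x. a * f x}"
proof -
  have "congruent (Lp_rel M p) (\<lambda>f. Lp_rel M p `` {\<lambda>x. a * f x})"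
  proof (rule congruentI)
    fix f f' assume f: "(f, f') \<in> Lp_rel M p"
    then have "AE x in M. f x = f' x"
      by (simp add: Lp_rel_def)
    then have "AE x in M. a * f x = a * f' x"
      by eventually_elim simp
    with f have "((\<lambda>x. a * f x), (\<lambda>x. a * f' x)) \<in> Lp_rel M p"
      by (simp add: Lp_rel_def Lp_fun_scale)
    then show "Lp_rel M p `` {\<lambda>x. a * f x} = Lp_rel M p `` {\<lambda>x. a * f' x}"
      by (rule equiv_class_eq[OF equiv_Lp_rel])
  qed
  from UN_equiv_class[OF equiv_Lp_rel this assms] show ?thesis
    by (simp add: Lp_def)
qed

lemma Lp_norm_class:
  assumes "f \<in> Lp_fun M p"
  shows "vnorm (Lp M p) (Lp_rel M p `` {f}) = Lp_fnorm M p f"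
proof -
  have "Lp_fnorm M p g = Lp_fnorm M p f" if "(f, g) \<in> Lp_rel M p" for g
  proof -
    have [measurable]: "f \<in> borel_measurable M" "g \<in> borel_measurable M"
      and "AE x in M. f x = g x"
      using that by (simp_all add: Lp_rel_def Lp_fun_def)
    from this(3) have "AE x in M. \<bar>g x\<bar> powr p = \<bar>f x\<bar> powr p"
      by eventually_elim simp
    then have "(\<integral>x. \<bar>g x\<bar> powr p \<partial>M) = (\<integral>x. \<bar>f x\<bar> powr p \<partial>M)"
      by (intro integral_cong_AE) measurable
    then show ?thesis by (simp add: Lp_fnorm_def)
  qed
  moreover have "f \<in> Lp_rel M p `` {f}"
    using equiv_class_self[OF equiv_Lp_rel assms] .
  ultimately have "Lp_fnorm M p ` (Lp_rel M p `` {f}) = {Lp_fnorm M p f}"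
    by blast
  then show ?thesis by (simp add: Lp_def)
qed

end

theory Submission
  imports Defs
begin

text \<open>
  Let \<open>D n\<close> be disjoint sets of positive finite measure, and let \<open>s n\<close> be the multiple of the
  indicator function of \<open>D n\<close> that has norm 1. Whenever \<open>f\<close> has little mass on \<open>D n\<close>, the functions
  \<open>f\<close> and \<open>s n\<close> are almost disjointly supported, so \<open>\<parallel>f - s n\<parallel>\<^sup>p\<close> is close to \<open>\<parallel>f\<parallel>\<^sup>p + 1\<close>. A fixed
  \<open>f\<close> has little mass on \<open>D n\<close> for large \<open>n\<close>, hence no finite set of unit vectors is much closer than
  \<open>2 powr (1 / p)\<close> to all \<open>s n\<close>. Conversely, every \<open>f\<close> in the unit ball has mass at most \<open>1 / n\<close> on
  one of the first \<open>n\<close> sets, so \<open>s 0, \<dots>, s (n - 1)\<close> are centres of balls of radius close to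
  \<open>2 powr (1 / p)\<close> that cover the unit ball.
\<close>

section \<open>Pointwise estimates for p-th powers of differences\<close>

text \<open>According to whether \<open>a\<close> is small or large relative to
  \<open>t * \<bar>b\<bar>\<close>, one term on the right suffices. For small \<open>t\<close> the
  factor of \<open>\<bar>b\<bar> powr p\<close> is near 1; the price is a large factor of
  \<open>\<bar>a\<bar> powr p\<close>, harmless where \<open>a\<close> has little mass.\<close>

lemma abs_diff_powr_le:
  fixes a b p t :: real
  assumes "0 < p" "0 < t"
  shows "\<bar>a - b\<bar> powr p \<le> (1 + t) powr p * \<bar>b\<bar> powr p + (1 + 1 / t) powr p * \<bar>a\<bar> powr p"
proof (cases "\<bar>a\<bar> \<le> t * \<bar>b\<bar>")
  case True
  then have "\<bar>a - b\<bar> powr p \<le> ((1 + t) * \<bar>b\<bar>) powr p"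
    using assms by (intro powr_mono2) (auto simp: algebra_simps)
  then show ?thesis
    using assms by (simp add: powr_mult add_increasing2)
next
  case False
  then have "\<bar>b\<bar> \<le> \<bar>a\<bar> / t"
    using assms by (simp add: field_simps)
  then have "\<bar>a - b\<bar> powr p \<le> ((1 + 1 / t) * \<bar>a\<bar>) powr p"
    using assms by (intro powr_mono2) (auto simp: algebra_simps)
  then show ?thesis
    using assms by (simp add: powr_mult add_increasing)
qed

text \<open>If \<open>\<bar>a\<bar>\<close> is at most \<open>t * \<bar>b\<bar>\<close>, the reverse
  triangle inequality applies; otherwise the left-hand side is at most 0.\<close>

lemma abs_diff_powr_ge:
  fixes a b p t :: real
  assumes "0 < p" "0 < t" "t \<le> 1"
  shows "(1 - t) powr p * \<bar>b\<bar> powr p - (1 / t) powr p * \<bar>a\<bar> powr p \<le> \<bar>a - b\<bar> powr p"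
proof (cases "\<bar>a\<bar> \<le> t * \<bar>b\<bar>")
  case True
  then have "(1 - t) * \<bar>b\<bar> \<le> \<bar>a - b\<bar>"
    by (simp add: left_diff_distrib)
  then have "((1 - t) * \<bar>b\<bar>) powr p \<le> \<bar>a - b\<bar> powr p"
    using assms by (intro powr_mono2) auto
  then have "(1 - t) powr p * \<bar>b\<bar> powr p \<le> \<bar>a - b\<bar> powr p"
    by (simp only: powr_mult)
  moreover have "0 \<le> (1 / t) powr p * \<bar>a\<bar> powr p"
    by simp
  ultimately show ?thesis
    by linarith
next
  case False
  have "(1 - t) powr p * \<bar>b\<bar> powr p \<le> 1 * \<bar>b\<bar> powr p"
    using assms by (intro mult_right_mono powr_le1) auto
  also have "\<dots> \<le> (1 / t * \<bar>a\<bar>) powr p"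
    unfolding mult_1 using False assms by (intro powr_mono2) (auto simp: field_simps)
  also have "\<dots> = (1 / t) powr p * \<bar>a\<bar> powr p"
    by (rule powr_mult)
  finally show ?thesis
    using powr_ge_zero[of "\<bar>a - b\<bar>" p] by linarith
qed

text \<open>\<open>measure\<close> has the default value 0 outside \<open>sets M\<close>, so
  positivity already yields measurability.\<close>

lemma sets_of_measure_pos: "0 < measure M A \<Longrightarrow> A \<in> sets M"
  by (metis less_irrefl measure_notin_sets)

section \<open>Balls and spheres of the quotient space in terms of integrals of p-th powers\<close>

lemma Lp_fun_diff:
  assumes "0 \<le> p" "f \<in> Lp_fun M p" "g \<in> Lp_fun M p"
  shows "(\<lambda>x. f x - g x) \<in> Lp_fun M p"
  using Lp_fun_add[OF assms(1,2) Lp_fun_scale[OF assms(3), of "- 1"]] by simp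

lemma Lp_carrierE:
  assumes "F \<in> vcarrier (Lp M p)"
  obtains f where "f \<in> Lp_fun M p" "F = Lp_rel M p `` {f}"
  using assms by (auto simp: Lp_def elim: quotientE)

lemma Lp_carrierI: "f \<in> Lp_fun M p \<Longrightarrow> Lp_rel M p `` {f} \<in> vcarrier (Lp M p)"
  by (auto simp: Lp_def intro: quotientI)

lemma Lp_fnorm_le_iff:
  assumes "0 < p" "0 \<le> r"
  shows "Lp_fnorm M p f \<le> r \<longleftrightarrow> (\<integral>x. \<bar>f x\<bar> powr p \<partial>M) \<le> r powr p"
proof -
  have I: "0 \<le> (\<integral>x. \<bar>f x\<bar> powr p \<partial>M)"
    by simp
  have "r = (r powr p) powr (1 / p)"
    using assms by (simp add: powr_powr)
  then have "Lp_fnorm M p f \<le> r \<longleftrightarrow> (\<integral>x. \<bar>f x\<bar> powr p \<partial>M) powr (1 / p) \<le> (r powr p) powr (1 / p)"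
    by (simp add: Lp_fnorm_def)
  also have "\<dots> \<longleftrightarrow> (\<integral>x. \<bar>f x\<bar> powr p \<partial>M) \<le> r powr p"
    using I assms powr_mono2[of "1 / p" "\<integral>x. \<bar>f x\<bar> powr p \<partial>M" "r powr p"]
      powr_less_mono2[of "1 / p" "r powr p" "\<integral>x. \<bar>f x\<bar> powr p \<partial>M"]
    by (meson divide_pos_pos less_imp_le not_le powr_ge_zero zero_less_one)
  finally show ?thesis .
qed

lemma Lp_fnorm_eq_1_iff:
  assumes "0 < p"
  shows "Lp_fnorm M p f = 1 \<longleftrightarrow> (\<integral>x. \<bar>f x\<bar> powr p \<partial>M) = 1"
proof -
  have "Lp_fnorm M p f powr p = (\<integral>x. \<bar>f x\<bar> powr p \<partial>M)"
    using assms by (simp add: Lp_fnorm_def powr_powr)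
  then show ?thesis
    by (auto simp: Lp_fnorm_def)
qed

lemma Lp_class_in_unit_ball_iff:
  assumes "0 < p" "f \<in> Lp_fun M p"
  shows "Lp_rel M p `` {f} \<in> unit_ball (Lp M p) \<longleftrightarrow> (\<integral>x. \<bar>f x\<bar> powr p \<partial>M) \<le> 1"
  using assms by (simp add: unit_ball_def Lp_carrierI Lp_norm_class Lp_fnorm_le_iff)

lemma Lp_class_in_unit_sphere_iff:
  assumes "0 < p" "f \<in> Lp_fun M p"
  shows "Lp_rel M p `` {f} \<in> unit_sphere (Lp M p) \<longleftrightarrow> (\<integral>x. \<bar>f x\<bar> powr p \<partial>M) = 1"
  using assms by (simp add: unit_sphere_def Lp_carrierI Lp_norm_class Lp_fnorm_eq_1_iff)

lemma Lp_class_in_vcball_iff: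
  assumes "0 < p" "f \<in> Lp_fun M p" "g \<in> Lp_fun M p" "0 \<le> r"
  shows "Lp_rel M p `` {f} \<in> vcball (Lp M p) (Lp_rel M p `` {g}) r \<longleftrightarrow>
    (\<integral>x. \<bar>f x - g x\<bar> powr p \<partial>M) \<le> r powr p"
proof -
  have "vdiff (Lp M p) (Lp_rel M p `` {f}) (Lp_rel M p `` {g}) = Lp_rel M p `` {\<lambda>x. f x - g x}"
    using assms Lp_add_class[OF _ assms(2) Lp_fun_scale[OF assms(3), of "- 1"]]
    by (simp add: vdiff_def Lp_scale_class)
  then show ?thesis
    using assms by (simp add: vcball_def Lp_carrierI Lp_norm_class Lp_fun_diff Lp_fnorm_le_iff)
qed

section \<open>Normalized indicator functions and distances to them\<close>

definition spike :: "'a measure \<Rightarrow> real \<Rightarrow> 'a set \<Rightarrow> 'a \<Rightarrow> real" where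
  "spike M p A x = measure M A powr (- 1 / p) * indicator A x"

lemma abs_spike_powr:
  assumes "0 < p" "0 < measure M A"
  shows "\<bar>spike M p A x\<bar> powr p = indicator A x / measure M A"
proof -
  have "(measure M A powr (- 1 / p)) powr p = measure M A powr - 1"
    unfolding powr_powr using assms by simp
  also have "\<dots> = 1 / measure M A"
    using assms by (simp add: powr_minus_divide del: powr_neg_one)
  finally show ?thesis
    using assms(1) by (simp add: spike_def indicator_def)
qed

lemma has_bochner_integral_spike:
  assumes "0 < p" "0 < measure M A"
  shows "has_bochner_integral M (\<lambda>x. \<bar>spike M p A x\<bar> powr p) 1"
proof -
  \<comment> \<open>\<open>measure\<close> also sends infinite measure to 0, so its positivity gives
    finiteness as well.\<close>
  have "A \<in> sets M" "emeasure M A < \<infinity>"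
    using assms(2) sets_of_measure_pos by (auto simp: measure_def top.not_eq_extremum[symmetric])
  then have "has_bochner_integral M (\<lambda>x. indicator A x / measure M A) (measure M A / measure M A)"
    by (intro has_bochner_integral_divide_zero has_bochner_integral_real_indicator)
  then show ?thesis
    using assms by (simp add: abs_spike_powr)
qed

lemma spike_in_Lp_fun:
  assumes "0 < p" "0 < measure M A"
  shows "spike M p A \<in> Lp_fun M p"
proof -
  have [measurable]: "A \<in> sets M"
    using assms(2) by (rule sets_of_measure_pos)
  have "spike M p A \<in> borel_measurable M"
    unfolding spike_def by measurable
  then show ?thesis
    using has_bochner_integral_spike[OF assms]
    by (auto simp: Lp_fun_def has_bochner_integral_iff)
qed

lemma integrable_indicator_Lp:
  assumes "f \<in> Lp_fun M p" "A \<in> sets M"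
  shows "integrable M (\<lambda>x. indicator A x * \<bar>f x\<bar> powr p)"
  using assms by (auto simp: Lp_fun_def intro: integrable_mult_indicator[where 'b=real, simplified])

text \<open>Off \<open>A\<close> the spike vanishes; on \<open>A\<close>,
  \<open>abs_diff_powr_le\<close> applies with the spike as \<open>b\<close>. Adding
  \<open>\<bar>f x\<bar> powr p\<close> on \<open>A\<close> too only weakens the bound and makes the
  full integral of \<open>f\<close> appear.\<close>

lemma integral_diff_spike_le:
  assumes "0 < p" "0 < t" "0 < measure M A" "f \<in> Lp_fun M p"
  shows "(\<integral>x. \<bar>f x - spike M p A x\<bar> powr p \<partial>M) \<le> (\<integral>x. \<bar>f x\<bar> powr p \<partial>M) + (1 + t) powr p
    + (1 + 1 / t) powr p * (\<integral>x. indicator A x * \<bar>f x\<bar> powr p \<partial>M)"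
proof -
  let ?s = "spike M p A"
  have A: "A \<in> sets M"
    using assms(3) by (rule sets_of_measure_pos)
  have int: "integrable M (\<lambda>x. \<bar>f x\<bar> powr p)" "integrable M (\<lambda>x. \<bar>?s x\<bar> powr p)"
    "integrable M (\<lambda>x. \<bar>f x - ?s x\<bar> powr p)" "(\<integral>x. \<bar>?s x\<bar> powr p \<partial>M) = 1"
    using assms spike_in_Lp_fun[OF assms(1,3)] Lp_fun_diff[of p f M ?s]
      has_bochner_integral_spike[OF assms(1,3)]
    by (auto simp: Lp_fun_def has_bochner_integral_iff)
  note int = int integrable_indicator_Lp[OF assms(4) A]
  have "(\<integral>x. \<bar>f x - ?s x\<bar> powr p \<partial>M) \<le> (\<integral>x. \<bar>f x\<bar> powr p + (1 + t) powr p * \<bar>?s x\<bar> powr p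
    + (1 + 1 / t) powr p * (indicator A x * \<bar>f x\<bar> powr p) \<partial>M)"
  proof (rule integral_mono)
    fix x
    show "\<bar>f x - ?s x\<bar> powr p \<le> \<bar>f x\<bar> powr p + (1 + t) powr p * \<bar>?s x\<bar> powr p
      + (1 + 1 / t) powr p * (indicator A x * \<bar>f x\<bar> powr p)"
    proof (cases "x \<in> A")
      case True
      then show ?thesis
        using abs_diff_powr_le[OF assms(1,2), of "f x" "?s x"]
          powr_ge_zero[of "\<bar>f x\<bar>" p] unfolding indicator_simps(1)[OF True] mult_1 by linarith
    qed (simp add: spike_def)
  qed (use int in auto)
  also have "\<dots> = (\<integral>x. \<bar>f x\<bar> powr p \<partial>M) + (1 + t) powr p
    + (1 + 1 / t) powr p * (\<integral>x. indicator A x * \<bar>f x\<bar> powr p \<partial>M)"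
    using int by simp
  finally show ?thesis .
qed

text \<open>On \<open>A\<close>, \<open>abs_diff_powr_ge\<close> applies with the spike as
  \<open>b\<close>. The summand 1 in \<open>1 + (1 / t) powr p\<close> cancels the part of the full
  integral of \<open>f\<close> that lies on \<open>A\<close>.\<close>

lemma integral_diff_spike_ge:
  assumes "0 < p" "0 < t" "t \<le> 1" "0 < measure M A" "f \<in> Lp_fun M p"
  shows "(\<integral>x. \<bar>f x\<bar> powr p \<partial>M) + (1 - t) powr p
    - (1 + (1 / t) powr p) * (\<integral>x. indicator A x * \<bar>f x\<bar> powr p \<partial>M)
    \<le> (\<integral>x. \<bar>spike M p A x - f x\<bar> powr p \<partial>M)"
proof -
  let ?s = "spike M p A"
  have A: "A \<in> sets M"
    using assms(4) by (rule sets_of_measure_pos)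
  have int: "integrable M (\<lambda>x. \<bar>f x\<bar> powr p)" "integrable M (\<lambda>x. \<bar>?s x\<bar> powr p)"
    "integrable M (\<lambda>x. \<bar>?s x - f x\<bar> powr p)" "(\<integral>x. \<bar>?s x\<bar> powr p \<partial>M) = 1"
    using assms spike_in_Lp_fun[OF assms(1,4)] Lp_fun_diff[of p ?s M f]
      has_bochner_integral_spike[OF assms(1,4)]
    by (auto simp: Lp_fun_def has_bochner_integral_iff)
  note int = int integrable_indicator_Lp[OF assms(5) A]
  have "(\<integral>x. \<bar>f x\<bar> powr p \<partial>M) + (1 - t) powr p
    - (1 + (1 / t) powr p) * (\<integral>x. indicator A x * \<bar>f x\<bar> powr p \<partial>M) =
    (\<integral>x. \<bar>f x\<bar> powr p + (1 - t) powr p * \<bar>?s x\<bar> powr p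
    - (1 + (1 / t) powr p) * (indicator A x * \<bar>f x\<bar> powr p) \<partial>M)"
    using int by simp
  also have "\<dots> \<le> (\<integral>x. \<bar>?s x - f x\<bar> powr p \<partial>M)"
  proof (rule integral_mono)
    fix x
    show "\<bar>f x\<bar> powr p + (1 - t) powr p * \<bar>?s x\<bar> powr p
      - (1 + (1 / t) powr p) * (indicator A x * \<bar>f x\<bar> powr p) \<le> \<bar>?s x - f x\<bar> powr p"
    proof (cases "x \<in> A")
      case True
      then show ?thesis
        using abs_diff_powr_ge[OF assms(1-3), of "?s x" "f x"]
        by (simp add: algebra_simps abs_minus_commute)
    qed (use assms(1) in \<open>simp add: spike_def\<close>)
  qed (use int in auto)
  finally show ?thesis .
qed

section \<open>Mass of an integrable function on disjoint sets\<close>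

lemma sum_integral_indicator_le:
  fixes g :: "'a \<Rightarrow> real" and D :: "nat \<Rightarrow> 'a set"
  assumes "disjoint_family D" "\<And>n. D n \<in> sets M" "integrable M g" "\<And>x. 0 \<le> g x"
  shows "(\<Sum>i<n. \<integral>x. indicator (D i) x * g x \<partial>M) \<le> (\<integral>x. g x \<partial>M)"
proof -
  have int: "integrable M (\<lambda>x. indicator (D i) x * g x)" for i
    using integrable_mult_indicator[OF assms(2,3), of i] by simp
  have "(\<Sum>i<n. \<integral>x. indicator (D i) x * g x \<partial>M) = (\<integral>x. (\<Sum>i<n. indicator (D i) x * g x) \<partial>M)"
    by (rule Bochner_Integration.integral_sum[symmetric]) (rule int)
  also have "\<dots> \<le> (\<integral>x. g x \<partial>M)"
  proof (rule integral_mono)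
    fix x
    have "disjoint_family_on D {..<n}"
      using assms(1) by (rule disjoint_family_on_mono[rotated]) simp
    then have "(\<Sum>i<n. indicator (D i) x * g x) = indicator (\<Union>i<n. D i) x * g x"
      by (simp add: indicator_UN_disjoint sum_distrib_right)
    also have "\<dots> \<le> g x"
      using assms(4) by (simp add: indicator_def)
    finally show "(\<Sum>i<n. indicator (D i) x * g x) \<le> g x" .
  qed (intro Bochner_Integration.integrable_sum int, rule assms(3))
  finally show ?thesis .
qed

text \<open>The masses are nonnegative with bounded partial sums, so they are the terms of a
  convergent series.\<close>

lemma integral_indicator_tendsto_0:
  fixes g :: "'a \<Rightarrow> real" and D :: "nat \<Rightarrow> 'a set"
  assumes "disjoint_family D" "\<And>n. D n \<in> sets M" "integrable M g" "\<And>x. 0 \<le> g x"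
  shows "(\<lambda>n. \<integral>x. indicator (D n) x * g x \<partial>M) \<longlonglongrightarrow> 0"
  using sum_integral_indicator_le[OF assms] assms(4)
  by (intro summable_LIMSEQ_zero summableI_nonneg_bounded) auto

section \<open>The thickness over a general measure space\<close>

theorem thickness_Lp:
  fixes D :: "nat \<Rightarrow> 'a set"
  assumes p: "0 < p" and disj: "disjoint_family D" and pos: "\<And>n. 0 < measure M (D n)"
  shows "thickness (Lp M p) = 2 powr (1 / p)"
proof -
  let ?X = "Lp M p" and ?cl = "\<lambda>f. Lp_rel M p `` {f}" and ?s = "\<lambda>n. spike M p (D n)"
  define S where "S = {\<epsilon>. \<epsilon> > 0 \<and>
     (\<exists>C. finite C \<and> C \<subseteq> unit_sphere ?X \<and> unit_ball ?X \<subseteq> (\<Union>c\<in>C. vcball ?X c \<epsilon>))}"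
  have D: "D n \<in> sets M" for n
    using pos by (rule sets_of_measure_pos)
  have s: "?s n \<in> Lp_fun M p" "(\<integral>x. \<bar>?s n x\<bar> powr p \<partial>M) = 1" for n
    by (fact spike_in_Lp_fun[OF p pos])
      (fact has_bochner_integral_integral_eq[OF has_bochner_integral_spike[OF p pos]])
  have lower: "2 powr (1 / p) \<le> \<epsilon>" if \<epsilon>S: "\<epsilon> \<in> S" for \<epsilon>
  proof -
    obtain C where \<epsilon>: "0 < \<epsilon>" and C: "finite C" "C \<subseteq> unit_sphere ?X"
      "unit_ball ?X \<subseteq> (\<Union>c\<in>C. vcball ?X c \<epsilon>)"
      using \<epsilon>S unfolding S_def by blast
    have "\<exists>f. f \<in> Lp_fun M p \<and> ?cl f = c" if "c \<in> C" for c
      using that C(2) by (auto simp: unit_sphere_def elim!: Lp_carrierE)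
    then obtain r where r: "\<And>c. c \<in> C \<Longrightarrow> r c \<in> Lp_fun M p" "\<And>c. c \<in> C \<Longrightarrow> ?cl (r c) = c"
      by metis
    have r1: "(\<integral>x. \<bar>r c x\<bar> powr p \<partial>M) = 1" if "c \<in> C" for c
      using that C(2) r(2)[OF that] Lp_class_in_unit_sphere_iff[OF p r(1)[OF that]] by auto
    let ?m = "\<lambda>c n. \<integral>x. indicator (D n) x * \<bar>r c x\<bar> powr p \<partial>M"
    have "(\<lambda>n. ?m c n) \<longlonglongrightarrow> 0" if "c \<in> C" for c
      using r(1)[OF that] by (intro integral_indicator_tendsto_0 disj D) (auto simp: Lp_fun_def)
    then have lim: "(\<lambda>n. \<Sum>c\<in>C. ?m c n) \<longlonglongrightarrow> (\<Sum>c\<in>C. 0)"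
      by (rule tendsto_sum)
    have bound: "1 + (1 - t) powr p \<le> \<epsilon> powr p" if t: "0 < t" "t \<le> 1" for t :: real
    proof -
      \<comment> \<open>The centre whose ball contains the n-th spike varies with \<open>n\<close>.
        Summing the masses over all of \<open>C\<close> removes this dependence, so that
        \<open>n\<close> can tend to infinity.\<close>
      have le: "1 + (1 - t) powr p - (1 + (1 / t) powr p) * (\<Sum>c\<in>C. ?m c n) \<le> \<epsilon> powr p" for n
      proof -
        have "?cl (?s n) \<in> unit_ball ?X"
          unfolding Lp_class_in_unit_ball_iff[OF p s(1)] s(2) by simp
        then obtain c where c: "c \<in> C" "?cl (?s n) \<in> vcball ?X c \<epsilon>"
          using C(3) by auto
        then have "(\<integral>x. \<bar>?s n x - r c x\<bar> powr p \<partial>M) \<le> \<epsilon> powr p"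
          using Lp_class_in_vcball_iff[OF p s(1) r(1)[OF c(1)], of \<epsilon> n] r(2)[OF c(1)] \<epsilon> by simp
        moreover have "?m c n \<le> (\<Sum>c\<in>C. ?m c n)"
          using c(1) C(1) by (intro member_le_sum) auto
        then have "(1 + (1 / t) powr p) * ?m c n \<le> (1 + (1 / t) powr p) * (\<Sum>c\<in>C. ?m c n)"
          by (rule mult_left_mono) (simp add: add_nonneg_nonneg)
        ultimately show ?thesis
          using integral_diff_spike_ge[OF p t pos r(1)[OF c(1)], of n] r1[OF c(1)] by linarith
      qed
      have "(\<lambda>n. 1 + (1 - t) powr p - (1 + (1 / t) powr p) * (\<Sum>c\<in>C. ?m c n))
        \<longlonglongrightarrow> 1 + (1 - t) powr p - (1 + (1 / t) powr p) * (\<Sum>c\<in>C. 0)"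
        by (intro tendsto_intros lim)
      from LIMSEQ_le_const2[OF this] le show ?thesis
        by simp
    qed
    \<comment> \<open>Only now may \<open>t\<close> tend to 0: the unbounded factor
      \<open>(1 / t) powr p\<close> has disappeared in the limit over \<open>n\<close>.\<close>
    have "((\<lambda>t::real. 1 + (1 - t) powr p) \<longlongrightarrow> 1 + (1 - 0) powr p) (at_right 0)"
      by (intro tendsto_intros) auto
    moreover have "eventually (\<lambda>t::real. 1 + (1 - t) powr p \<le> \<epsilon> powr p) (at_right 0)"
      using bound by (auto simp: eventually_at_right_field intro!: exI[of _ 1])
    ultimately have "1 + (1 - 0) powr p \<le> \<epsilon> powr p"
      by (rule tendsto_upperbound) simp
    then have "2 powr (1 / p) \<le> (\<epsilon> powr p) powr (1 / p)"
      using p by (intro powr_mono2) auto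
    then show ?thesis
      using p \<epsilon> by (simp add: powr_powr)
  qed
  have upper: "\<epsilon> \<in> S" if \<epsilon>: "2 powr (1 / p) < \<epsilon>" for \<epsilon>
  proof -
    have \<epsilon>0: "0 < \<epsilon>"
      using \<epsilon> by (rule le_less_trans[rotated]) simp
    have "(2 powr (1 / p)) powr p < \<epsilon> powr p"
      using p \<epsilon> by (intro powr_less_mono2) auto
    then have two: "2 < \<epsilon> powr p"
      using p by (simp add: powr_powr)
    \<comment> \<open>The gap between 2 and \<open>\<epsilon> powr p\<close> is spent in two stages:
      \<open>t\<close> is fixed first, and then \<open>n\<close> is taken so large, depending on
      \<open>t\<close> through \<open>K\<close>, that the mass term fits into what remains.\<close>
    have "((\<lambda>t::real. 1 + (1 + t) powr p) \<longlongrightarrow> 1 + (1 + 0) powr p) (at_right 0)"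
      by (intro tendsto_intros) auto
    then have "eventually (\<lambda>t::real. 1 + (1 + t) powr p < \<epsilon> powr p) (at_right 0)"
      using two by (intro order_tendstoD(2)) auto
    then obtain t :: real where t: "0 < t" "1 + (1 + t) powr p < \<epsilon> powr p"
      unfolding eventually_at_right_field by (metis dense)
    define K where "K = (1 + 1 / t) powr p"
    have "(\<lambda>n. 1 + (1 + t) powr p + K * inverse (real (Suc n))) \<longlonglongrightarrow> 1 + (1 + t) powr p + K * 0"
      by (intro tendsto_intros LIMSEQ_inverse_real_of_nat)
    then have "eventually (\<lambda>n. 1 + (1 + t) powr p + K * inverse (real (Suc n)) < \<epsilon> powr p) sequentially"
      using t by (intro order_tendstoD(2)) auto
    then obtain n where n: "1 + (1 + t) powr p + K * inverse (real (Suc n)) < \<epsilon> powr p"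
      by (auto simp: eventually_sequentially)
    let ?C = "(\<lambda>i. ?cl (?s i)) ` {..<Suc n}"
    have "F \<in> (\<Union>c\<in>?C. vcball ?X c \<epsilon>)" if F: "F \<in> unit_ball ?X" for F
    proof -
      obtain f where f: "f \<in> Lp_fun M p" "F = ?cl f"
        using F by (auto simp: unit_ball_def elim: Lp_carrierE)
      have f1: "(\<integral>x. \<bar>f x\<bar> powr p \<partial>M) \<le> 1"
        using F f Lp_class_in_unit_ball_iff[OF p f(1)] by simp
      let ?m = "\<lambda>i. \<integral>x. indicator (D i) x * \<bar>f x\<bar> powr p \<partial>M"
      \<comment> \<open>Pigeonhole: otherwise the \<open>Suc n\<close> masses would sum to more than
        1. Counting up to \<open>Suc n\<close> keeps the index set nonempty, as the strict
        inequality of sums requires.\<close>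
      have "\<exists>i<Suc n. ?m i \<le> inverse (real (Suc n))"
      proof (rule ccontr)
        assume "\<not> ?thesis"
        then have "(\<Sum>i<Suc n. inverse (real (Suc n))) < (\<Sum>i<Suc n. ?m i)"
          by (intro sum_strict_mono) (auto simp: not_le)
        also have "\<dots> \<le> (\<integral>x. \<bar>f x\<bar> powr p \<partial>M)"
          using f(1) by (intro sum_integral_indicator_le disj D) (auto simp: Lp_fun_def)
        finally show False
          using f1 by simp
      qed
      then obtain i where i: "i < Suc n" "?m i \<le> inverse (real (Suc n))"
        by blast
      then have "K * ?m i \<le> K * inverse (real (Suc n))"
        by (intro mult_left_mono) (auto simp: K_def)
      then have "(\<integral>x. \<bar>f x - ?s i x\<bar> powr p \<partial>M) \<le> \<epsilon> powr p"
        using integral_diff_spike_le[OF p t(1) pos f(1), of i] f1 n unfolding K_def by linarith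
      then have "F \<in> vcball ?X (?cl (?s i)) \<epsilon>"
        using Lp_class_in_vcball_iff[OF p f(1) s(1)] f(2) \<epsilon>0 by simp
      then show ?thesis
        using i(1) by blast
    qed
    moreover have "?C \<subseteq> unit_sphere ?X"
      using Lp_class_in_unit_sphere_iff[OF p s(1)] s(2) by blast
    ultimately show ?thesis
      unfolding S_def using \<epsilon>0 by (intro CollectI conjI exI[of _ ?C]) auto
  qed
  have "Inf S = 2 powr (1 / p)"
  proof (rule antisym)
    show "2 powr (1 / p) \<le> Inf S"
    proof (rule cInf_greatest)
      have "2 powr (1 / p) + 1 \<in> S"
        by (rule upper) simp
      then show "S \<noteq> {}"
        by blast
    qed (rule lower)
    show "Inf S \<le> 2 powr (1 / p)"
    \<comment> \<open>Membership in \<open>S\<close> is known only for radii strictly above the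
      bound, so the infimum is compared with all of these.\<close>
    proof (rule dense_ge)
      show "Inf S \<le> \<epsilon>" if "2 powr (1 / p) < \<epsilon>" for \<epsilon>
        by (rule cInf_lower[OF upper[OF that] bdd_belowI[OF lower]])
    qed
  qed
  then show ?thesis
    unfolding thickness_def S_def .
qed

section \<open>The unit interval\<close>

theorem theorem1:
  fixes p :: real
  assumes "1 \<le> p"
  shows "thickness (Lp (lebesgue_on {0..1::real}) p) = 2 powr (1 / p)"
proof (rule thickness_Lp)
  \<comment> \<open>Consecutive reciprocals cut \<open>{0<..1}\<close> into intervals, starting with
    \<open>{1/2<..1}\<close> at \<open>n = 0\<close>. Neighbours share an endpoint, which the
    half-open form assigns to only one of them.\<close>
  let ?D = "\<lambda>n::nat. {1 / (real n + 2)<..1 / (real n + 1)}"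
  show "0 < p"
    using assms by simp
  have less: "?D m \<inter> ?D n = {}" if "m < n" for m n
  proof -
    have "1 / (real n + 1) \<le> 1 / (real m + 2)"
      using that by (intro divide_left_mono) auto
    then show ?thesis
      by auto
  qed
  have "?D m \<inter> ?D n = {}" if "m \<noteq> n" for m n
    using that less[of m n] less[of n m] by (cases m n rule: linorder_cases) blast+
  then show "disjoint_family ?D"
    unfolding disjoint_family_on_def by blast
  show "0 < measure (lebesgue_on {0..1}) (?D n)" for n
  proof -
    have "0 \<le> 1 / (real n + 2)" "1 / (real n + 1) \<le> 1"
      by simp_all
    then have "?D n \<subseteq> {0..1}"
      unfolding greaterThanAtMost_subseteq_atLeastAtMost_iff by blast
    \<comment> \<open>The interval is Borel and lies in \<open>{0..1}\<close>, so neither completion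
      nor restriction changes its measure.\<close>
    then have "measure (lebesgue_on {0..1}) (?D n) = measure lborel (?D n)"
      by (simp add: measure_restrict_space)
    moreover have "1 / (real n + 2) < 1 / (real n + 1)"
      by (intro divide_strict_left_mono) auto
    ultimately show ?thesis
      by (metis diff_gt_0_iff_gt less_imp_le measure_lborel_Ioc)
  qed
qed

end
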